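(* Let $G$ be a finite group, $V$ an $\mathbb{R}$-linear representation of $G$, and $q\geq 1$. For any subgroup $H$ of $G$, the $H$-fixed point set of $\mathrm{Conf}(V,q)$ is $\mathrm{Conf}(V,q)^H=\mathrm{Conf}(V^H,q)$.
   Context: For a space $M$, $\mathrm{Conf}(M,q)=\{(x_1,\dots,x_q)\in M^q \mid x_i\neq x_j \text{ for } i\neq j\}$ is the ordered configuration space. For a representation $V$ of $G$, $\mathrm{Conf}(V,q)$ carries the diagonal action $g\cdot(x_1,\dots,x_q)=(g x_1,\dots,g x_q)$. $X^H$ denotes the set of points of $X$ fixed by every element of $H$. *)

theory Defs
  imports Complex_Main "HOL-Algebra.Group_Action"
begin

text \<open>A representation on the real vector space given by the whole type \<open>'v\<close>, of arbitrary
  dimension: the group action supplies the homomorphism into the bijections of \<open>'v\<close>, and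
  linearity puts its values into the general linear group.\<close>

locale real_representation = group_action G UNIV \<phi>
  for G :: "('g, 'm) monoid_scheme" (structure) and \<phi> :: "'g \<Rightarrow> 'v::real_vector \<Rightarrow> 'v" +
  assumes linear_action: "g \<in> carrier G \<Longrightarrow> linear (\<phi> g)"

text \<open>A \<open>q\<close>-tuple in \<open>M\<close> is a function on \<open>{1..q}\<close>, extended by \<^term>\<open>undefined\<close>
  outside of it, so that equality of tuples is equality of functions.\<close>

definition Conf :: "'a set \<Rightarrow> nat \<Rightarrow> (nat \<Rightarrow> 'a) set" where
  "Conf M q = {x \<in> {1..q} \<rightarrow>\<^sub>E M. \<forall>i\<in>{1..q}. \<forall>j\<in>{1..q}. i \<noteq> j \<longrightarrow> x i \<noteq> x j}"

text \<open>The outer restriction to the configuration space is the convention of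
  \<^const>\<open>BijGroup\<close>, which makes this a \<^const>\<open>group_action\<close> in the sense of the library.\<close>

definition diagonal_action ::
    "('g \<Rightarrow> 'a \<Rightarrow> 'a) \<Rightarrow> 'a set \<Rightarrow> nat \<Rightarrow> 'g \<Rightarrow> (nat \<Rightarrow> 'a) \<Rightarrow> (nat \<Rightarrow> 'a)" where
  "diagonal_action \<phi> M q g = (\<lambda>x\<in>Conf M q. \<lambda>i\<in>{1..q}. \<phi> g (x i))"

definition fixed_points :: "('g \<Rightarrow> 'x \<Rightarrow> 'x) \<Rightarrow> 'x set \<Rightarrow> 'g set \<Rightarrow> 'x set" where
  "fixed_points \<phi> X H = {x \<in> X. \<forall>h\<in>H. \<phi> h x = x}"

lemma diagonal_action_closed:
  assumes "group_action G M \<phi>" "g \<in> carrier G" "x \<in> Conf M q"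
  shows "diagonal_action \<phi> M q g x \<in> Conf M q"
proof -
  interpret group_action G M \<phi> by fact
  have "inj_on (\<phi> g) M" and "\<And>y. y \<in> M \<Longrightarrow> \<phi> g y \<in> M"
    using inj_prop[OF assms(2)] element_image[OF assms(2)] by auto
  moreover have "\<And>i. i \<in> {1..q} \<Longrightarrow> x i \<in> M"
    and "\<And>i j. i \<in> {1..q} \<Longrightarrow> j \<in> {1..q} \<Longrightarrow> i \<noteq> j \<Longrightarrow> x i \<noteq> x j"
    using assms(3) by (auto simp: Conf_def)
  ultimately have "(\<lambda>i\<in>{1..q}. \<phi> g (x i)) \<in> Conf M q"
    by (simp add: Conf_def PiE_iff inj_on_eq_iff)
  with assms(3) show ?thesis
    by (simp add: diagonal_action_def)
qed

lemma diagonal_action_mult: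
  assumes "group_action G M \<phi>" "g \<in> carrier G" "h \<in> carrier G" "x \<in> Conf M q"
  shows "diagonal_action \<phi> M q (g \<otimes>\<^bsub>G\<^esub> h) x
    = diagonal_action \<phi> M q g (diagonal_action \<phi> M q h x)"
proof -
  interpret group_action G M \<phi> by fact
  have "diagonal_action \<phi> M q h x \<in> Conf M q"
    using diagonal_action_closed[OF assms(1,3,4)] .
  moreover have "\<And>i. i \<in> {1..q} \<Longrightarrow> x i \<in> M"
    using assms(4) by (auto simp: Conf_def PiE_iff)
  ultimately show ?thesis
    using assms(4) composition_rule[OF _ assms(2,3)]
    by (auto simp: diagonal_action_def restrict_def)
qed

lemma diagonal_action_one:
  assumes "group_action G M \<phi>" "x \<in> Conf M q"
  shows "diagonal_action \<phi> M q \<one>\<^bsub>G\<^esub> x = x"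
proof -
  interpret group_action G M \<phi> by fact
  have "\<And>y. y \<in> M \<Longrightarrow> \<phi> \<one>\<^bsub>G\<^esub> y = y"
    using id_eq_one by (metis restrict_apply')
  with assms(2) show ?thesis
    by (auto simp: diagonal_action_def Conf_def PiE_iff extensional_def fun_eq_iff)
qed

theorem group_action_diagonal:
  assumes "group_action G M \<phi>"
  shows "group_action G (Conf M q) (diagonal_action \<phi> M q)"
proof -
  interpret group_action G M \<phi> by fact
  let ?d = "diagonal_action \<phi> M q"
  have G: "group G" using group_hom by (simp add: group_hom_def)
  have bij: "?d g \<in> Bij (Conf M q)" if g: "g \<in> carrier G" for g
  proof -
    have i: "inv\<^bsub>G\<^esub> g \<in> carrier G" using G g by (rule group.inv_closed)
    have "bij_betw (?d g) (Conf M q) (Conf M q)"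
    proof (rule bij_betw_byWitness[where f' = "?d (inv\<^bsub>G\<^esub> g)"])
      show "\<forall>x\<in>Conf M q. ?d (inv\<^bsub>G\<^esub> g) (?d g x) = x"
        using diagonal_action_mult[OF assms i g] diagonal_action_one[OF assms]
          group.l_inv[OF G g] by metis
      show "\<forall>x\<in>Conf M q. ?d g (?d (inv\<^bsub>G\<^esub> g) x) = x"
        using diagonal_action_mult[OF assms g i] diagonal_action_one[OF assms]
          group.r_inv[OF G g] by metis
    qed (use diagonal_action_closed[OF assms] g i in auto)
    then show ?thesis
      by (auto simp: Bij_def diagonal_action_def)
  qed
  have "?d (g \<otimes>\<^bsub>G\<^esub> h) = compose (Conf M q) (?d g) (?d h)"
    if "g \<in> carrier G" "h \<in> carrier G" for g h
  proof (rule extensionalityI[of _ "Conf M q"])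
    show "?d (g \<otimes>\<^bsub>G\<^esub> h) \<in> extensional (Conf M q)"
      by (simp add: diagonal_action_def)
  qed (use diagonal_action_mult[OF assms that] in \<open>auto simp: compose_def\<close>)
  then show ?thesis
    using bij G group_BijGroup
    by (auto simp: group_action_def group_hom_def group_hom_axioms_def hom_def BijGroup_def)
qed

end

theory Submission
  imports Defs
begin

text \<open>The diagonal action moves every coordinate of a configuration separately. So a group
  element fixes a configuration exactly when it fixes each of its points
  (\<open>diagonal_action_fixes_iff\<close>), and a configuration fixed by all of \<open>H\<close> is one whose points
  all lie in the fixed point set of \<open>H\<close>. The points of a configuration are required to be distinct
  whatever the ambient set is, so this condition is the same on both sides.\<close>

lemma diagonal_action_fixes_iff:
  assumes "x \<in> Conf M q"
  shows "diagonal_action \<phi> M q g x = x \<longleftrightarrow> (\<forall>i\<in>{1..q}. \<phi> g (x i) = x i)"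
proof -
  \<comment> \<open>Outside \<open>{1..q}\<close> both tuples take the value \<^term>\<open>undefined\<close>, so that only the
    coordinates in \<open>{1..q}\<close> have to be compared.\<close>
  have "x \<in> extensional {1..q}"
    using assms by (simp add: Conf_def PiE_iff)
  then have "(\<lambda>i\<in>{1..q}. \<phi> g (x i)) = x \<longleftrightarrow> (\<forall>i\<in>{1..q}. \<phi> g (x i) = x i)"
    by (auto simp: fun_eq_iff extensional_def)
  with assms show ?thesis
    by (simp add: diagonal_action_def)
qed

lemma fixed_points_Conf:
  "fixed_points (diagonal_action \<phi> M q) (Conf M q) H = Conf (fixed_points \<phi> M H) q"
proof -
  have "fixed_points (diagonal_action \<phi> M q) (Conf M q) H
      = {x \<in> Conf M q. \<forall>h\<in>H. \<forall>i\<in>{1..q}. \<phi> h (x i) = x i}"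
    by (auto simp: fixed_points_def diagonal_action_fixes_iff)
  also have "\<dots> = Conf (fixed_points \<phi> M H) q"
    by (auto simp: Conf_def fixed_points_def PiE_iff)
  finally show ?thesis .
qed

theorem theorem7p1:
  fixes G :: "('g, 'm) monoid_scheme"
    and \<phi> :: "'g \<Rightarrow> 'v::real_vector \<Rightarrow> 'v"
    and H :: "'g set" and q :: nat
  assumes "finite (carrier G)"
    and "real_representation G \<phi>"
    and "q \<ge> 1"
    and "subgroup H G"
  shows "fixed_points (diagonal_action \<phi> UNIV q) (Conf UNIV q) H
    = Conf (fixed_points \<phi> UNIV H) q"
  by (rule fixed_points_Conf)

end
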